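(* Let $\Gamma$ be a finite set of monoidal functional dependencies over a denumerable set $\mathrm{Var}$, and let $A \Rightarrow B$ be a monoidal functional dependency over $\mathrm{Var}$. Then $\Gamma \models A \Rightarrow B$ (semantic entailment over all integral commutative pomonoids) if and only if $A \Rightarrow B$ is semantically entailed by $\Gamma$ in the relational sense, i.e. every relational model of $\Gamma$ satisfies $A \Rightarrow B$.
   Context: Let $\mathrm{Var}$ be a fixed denumerable set (propositional variables, also called attributes). A finite multiset over $\mathrm{Var}$ is a map $A\colon \mathrm{Var} \to \mathbb{Z}$ with $A(p) \ge 0$ for all $p$ and $\{p : A(p) > 0\}$ finite. A monoidal functional dependency (MFD) is an expression $A \Rightarrow B$ with $A,B$ finite multisets over $\mathrm{Var}$. An integral commutative pomonoid is $\mathbf{L} = \langle L,\le,\otimes,1\rangle$ where $\langle L,\otimes,1\rangle$ is a commutative monoid, $\le$ is a partial order on $L$, $\otimes$ is monotone with respect to $\le$, and $1$ is the greatest element. Powers: $a^0=1$, $a^{n+1} = a \otimes a^n$. Propositional semantics: an $\mathbf{L}$-evaluation is a map $e\colon \mathrm{Var} \to L$, extended to multisets by $e(A) = e(p_1)^{A(p_1)} \otimes\cdots\otimes e(p_n)^{A(p_n)}$ where $\{p : A(p)>0\} \subseteq \{p_1,\dots,p_n\}$ ($p_i$ distinct). Write $e \models A \Rightarrow B$ if $e(A) \le e(B)$. $e$ is an $\mathbf{L}$-model of $\Gamma$ if $e\models E\Rightarrow F$ for all $E\Rightarrow F\in\Gamma$. $\Gamma \models A \Rightarrow B$ means: for every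 integral commutative pomonoid $\mathbf{L}$ and every $\mathbf{L}$-model $e$ of $\Gamma$, $e \models A \Rightarrow B$. Relational semantics: let $R = \{p_1,\dots,p_n\}$ be a finite subset of $\mathrm{Var}$ (a relation scheme) containing all variables $p$ that occur (have positive multiplicity) in $A$, $B$ or in a formula of $\Gamma$. A relation $\mathbf{r}$ on $R$ is a finite set of tuples, i.e. of maps $r$ on $R$ with $r(p) \in D^{\mathbf{r}}_p$ for each $p\in R$, where $D^{\mathbf{r}}_p$ is a set (the domain of $p$ in $\mathbf{r}$); it comes with an integral commutative pomonoid $\mathbf{L}$ and, for each $p \in R$, a map $\approx^{\mathbf{r}}_p\colon D^{\mathbf{r}}_p\times D^{\mathbf{r}}_p \to L$ such that $d \approx^{\mathbf{r}}_p d = 1$ for all $d\in D^{\mathbf{r}}_p$ (no other conditions are imposed). For a multiset $E$ whose variables lie in $R$ and tuples $r_1,r_2\in\mathbf{r}$ put $$r_1 \approx^{\mathbf{r}}_E r_2 = \bigl(r_1(p_1)\approx^{\mathbf{r}}_{p_1} r_2(p_1)\bigr)^{E(p_1)}\otimes\cdots\otimes\bigl(r_1(p_n)\approx^{\mathbf{r}}_{p_n} r_2(p_n)\bigr)^{E(p_n)}.$$ $\mathbf{r}$ satisfies $E\Rightarrow F$ if $r_1\approx^{\mathbf{r}}_E r_2 \le r_1\approx^{\mathbf{r}}_F r_2$ for all $r_1,r_2\in\mathbf{r}$. A relational model of $\Gamma$ is a relation (over any integral commutative pomonoid $\mathbf{L}$, any domains and any such maps $\approx^{\mathbf{r}}_p$)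 satisfying every MFD in $\Gamma$. *)

theory Defs
  imports
    "HOL-Algebra.FiniteProduct"
    "HOL-Library.Multiset"
    "HOL-Library.Countable"
    "HOL-Library.Infinite_Typeclass"
begin

record 'a pomonoid = "'a monoid" +
  leq :: "'a \<Rightarrow> 'a \<Rightarrow> bool" (infix "\<preceq>\<index>" 50)

locale integral_comm_pomonoid = comm_monoid L for L :: "'a pomonoid" (structure) +
  assumes le_refl: "reflp_on (carrier L) (leq L)"
    and le_antisym: "antisymp_on (carrier L) (leq L)"
    and le_trans: "transp_on (carrier L) (leq L)"
    and mult_mono: "\<lbrakk>a \<in> carrier L; b \<in> carrier L; c \<in> carrier L; d \<in> carrier L;
                     a \<preceq> b; c \<preceq> d\<rbrakk> \<Longrightarrow> a \<otimes> c \<preceq> b \<otimes> d"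
    and le_one: "a \<in> carrier L \<Longrightarrow> a \<preceq> \<one>"

datatype 'v mfd = MFD (lhs: "'v multiset") (rhs: "'v multiset") (infix "\<leadsto>" 55)

definition mfd_vars :: "'v mfd \<Rightarrow> 'v set" where
  "mfd_vars \<phi> = set_mset (lhs \<phi>) \<union> set_mset (rhs \<phi>)"


definition evaluation :: "'l pomonoid \<Rightarrow> ('v \<Rightarrow> 'l) \<Rightarrow> bool" where
  "evaluation L e \<longleftrightarrow> (\<forall>p. e p \<in> carrier L)"

definition eval_mset :: "'l pomonoid \<Rightarrow> ('v \<Rightarrow> 'l) \<Rightarrow> 'v multiset \<Rightarrow> 'l" where
  "eval_mset L e A = (\<Otimes>\<^bsub>L\<^esub>p \<in> set_mset A. e p [^]\<^bsub>L\<^esub> count A p)"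

definition eval_sat :: "'l pomonoid \<Rightarrow> ('v \<Rightarrow> 'l) \<Rightarrow> 'v mfd \<Rightarrow> bool" where
  "eval_sat L e \<phi> \<longleftrightarrow> eval_mset L e (lhs \<phi>) \<preceq>\<^bsub>L\<^esub> eval_mset L e (rhs \<phi>)"

definition eval_model :: "'l pomonoid \<Rightarrow> ('v \<Rightarrow> 'l) \<Rightarrow> 'v mfd set \<Rightarrow> bool" where
  "eval_model L e \<Gamma> \<longleftrightarrow> evaluation L e \<and> (\<forall>\<phi>\<in>\<Gamma>. eval_sat L e \<phi>)"

(* HOL cannot quantify over types inside a formula. Entailment is therefore relative to a type 'l
   whose subsets serve as the carriers of the pomonoids; the type is passed as an argument.
   Entailment over all pomonoids is obtained by letting 'l range over all infinite types: a
   pomonoid on a finite type is isomorphic to one on a finite subset of an infinite type. *)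
definition entails :: "'l itself \<Rightarrow> 'v mfd set \<Rightarrow> 'v mfd \<Rightarrow> bool" where
  "entails (_ :: 'l itself) \<Gamma> \<phi> \<longleftrightarrow>
     (\<forall>(L :: 'l pomonoid) e.
        integral_comm_pomonoid L \<longrightarrow> eval_model L e \<Gamma> \<longrightarrow> eval_sat L e \<phi>)"


record ('v, 'd, 'l) mrelation =
  tuples :: "('v \<Rightarrow> 'd) set"
  attr_domain :: "'v \<Rightarrow> 'd set"
  degrees :: "'l pomonoid"
  similarity :: "'v \<Rightarrow> 'd \<Rightarrow> 'd \<Rightarrow> 'l"

(* Tuples on R are extensional functions, so that they are determined by their values on R. *)
locale relation_on =
  fixes R :: "'v set" and r :: "('v, 'd, 'l) mrelation"
  assumes finite_scheme: "finite R"
    and finite_tuples: "finite (tuples r)"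
    and tuples_subset: "tuples r \<subseteq> (\<Pi>\<^sub>E p\<in>R. attr_domain r p)"
    and degrees_pomonoid: "integral_comm_pomonoid (degrees r)"
    and similarity_closed: "\<lbrakk>p \<in> R; d \<in> attr_domain r p; d' \<in> attr_domain r p\<rbrakk>
          \<Longrightarrow> similarity r p d d' \<in> carrier (degrees r)"
    and similarity_refl: "\<lbrakk>p \<in> R; d \<in> attr_domain r p\<rbrakk> \<Longrightarrow> similarity r p d d = \<one>\<^bsub>degrees r\<^esub>"

definition tuple_similarity ::
  "'v set \<Rightarrow> ('v, 'd, 'l) mrelation \<Rightarrow> 'v multiset \<Rightarrow> ('v \<Rightarrow> 'd) \<Rightarrow> ('v \<Rightarrow> 'd) \<Rightarrow> 'l" where
  "tuple_similarity R r E t1 t2 =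
     (\<Otimes>\<^bsub>degrees r\<^esub>p \<in> R. similarity r p (t1 p) (t2 p) [^]\<^bsub>degrees r\<^esub> count E p)"

definition rel_sat :: "'v set \<Rightarrow> ('v, 'd, 'l) mrelation \<Rightarrow> 'v mfd \<Rightarrow> bool" where
  "rel_sat R r \<phi> \<longleftrightarrow>
     (\<forall>t1\<in>tuples r. \<forall>t2\<in>tuples r.
        tuple_similarity R r (lhs \<phi>) t1 t2 \<preceq>\<^bsub>degrees r\<^esub> tuple_similarity R r (rhs \<phi>) t1 t2)"

definition rel_model :: "'v set \<Rightarrow> ('v, 'd, 'l) mrelation \<Rightarrow> 'v mfd set \<Rightarrow> bool" where
  "rel_model R r \<Gamma> \<longleftrightarrow> relation_on R r \<and> (\<forall>\<phi>\<in>\<Gamma>. rel_sat R r \<phi>)"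

(* The domains of the attributes are subsets of the type 'd, the pomonoids live on subsets of 'l. *)
definition rel_entails ::
  "'d itself \<Rightarrow> 'l itself \<Rightarrow> 'v set \<Rightarrow> 'v mfd set \<Rightarrow> 'v mfd \<Rightarrow> bool" where
  "rel_entails (_ :: 'd itself) (_ :: 'l itself) R \<Gamma> \<phi> \<longleftrightarrow>
     (\<forall>r :: ('v, 'd, 'l) mrelation. rel_model R r \<Gamma> \<longrightarrow> rel_sat R r \<phi>)"

(* eval_mset does not depend on the finite set of variables over which the product is taken. *)
lemma (in integral_comm_pomonoid) eval_mset_superset:
  assumes "evaluation L e" "finite S" "set_mset A \<subseteq> S"
  shows "eval_mset L e A = (\<Otimes>p\<in>S. e p [^] count A p)"
  unfolding eval_mset_def
  by (rule finprod_mono_neutral_cong_left)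
     (use assms in \<open>auto simp: evaluation_def not_in_iff\<close>)

end

theory Submission imports Defs "HOL-Library.Countable_Set" begin

text \<open>
  An evaluation \<open>e\<close> and the similarity degrees of a pair of tuples are the same data: a pair of
  tuples \<open>t\<^sub>1, t\<^sub>2\<close> yields the evaluation sending \<open>p\<close> to the similarity of \<open>t\<^sub>1(p)\<close> and \<open>t\<^sub>2(p)\<close>, and
  conversely \<open>e\<close> is realised by two tuples that differ everywhere on \<open>R\<close>, with \<open>e(p)\<close> as the
  similarity of their values at \<open>p\<close>. On the diagonal both sides of every dependency are \<open>1\<close>. The
  truth of a dependency under \<open>e\<close> depends only on the submonoid of values of multisets, which is
  countable; hence it has a copy inside every infinite type, and entailment does not depend on
  the type that carries the pomonoids.
\<close>

context integral_comm_pomonoid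
begin

lemma eval_mset_closed [simp]:
  assumes "evaluation L e"
  shows "eval_mset L e A \<in> carrier L"
  using assms unfolding eval_mset_def evaluation_def by (intro finprod_closed) auto

lemma eval_mset_empty [simp]: "eval_mset L e {#} = \<one>"
  by (simp add: eval_mset_def)

text \<open>Over the joint support all three products share one index set, so exponents add factor
  by factor.\<close>

lemma eval_mset_union:
  assumes "evaluation L e"
  shows "eval_mset L e (A + B) = eval_mset L e A \<otimes> eval_mset L e B"
proof -
  let ?S = "set_mset A \<union> set_mset B"
  have e: "e p \<in> carrier L" for p
    using assms by (simp add: evaluation_def)
  have "eval_mset L e (A + B) = (\<Otimes>p\<in>?S. e p [^] count A p \<otimes> e p [^] count B p)"
    using assms by (simp add: eval_mset_superset[of e ?S] nat_pow_mult e)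
  also have "\<dots> = eval_mset L e A \<otimes> eval_mset L e B"
    using assms e by (simp add: eval_mset_superset[of e ?S] finprod_multf)
  finally show ?thesis .
qed

lemma eval_mset_single [simp]:
  assumes "evaluation L e"
  shows "eval_mset L e {#p#} = e p"
  using assms by (simp add: eval_mset_def evaluation_def)

end

text \<open>Transport of structure from a part \<open>C\<close> of \<open>L\<close> to another type.
  Pulling back along \<open>inv_into C h\<close> is meaningful when \<open>h\<close> is injective on
  \<open>C\<close> and \<open>C\<close> is a submonoid.\<close>

definition image_pomonoid :: "('a \<Rightarrow> 'b) \<Rightarrow> 'a set \<Rightarrow> 'a pomonoid \<Rightarrow> 'b pomonoid" where
  "image_pomonoid h C L =
     \<lparr>carrier = h ` C,
      monoid.mult = \<lambda>x y. h (inv_into C h x \<otimes>\<^bsub>L\<^esub> inv_into C h y),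
      one = h \<one>\<^bsub>L\<^esub>,
      leq = \<lambda>x y. inv_into C h x \<preceq>\<^bsub>L\<^esub> inv_into C h y\<rparr>"

context integral_comm_pomonoid
begin

lemma image_pomonoid:
  assumes "inj_on h C" and C: "submonoid C L"
  shows "integral_comm_pomonoid (image_pomonoid h C L)"
proof -
  have inv [simp]: "inv_into C h (h x) = x" if "x \<in> C" for x
    using assms that by simp
  have C_carrier [simp]: "x \<in> carrier L" if "x \<in> C" for x
    using C that by (meson submonoid.mem_carrier)
  have C_mult [simp]: "x \<otimes> y \<in> C" if "x \<in> C" "y \<in> C" for x y
    using C that by (meson submonoid.m_closed)
  have C_one [simp]: "\<one> \<in> C"
    using C by (meson submonoid.one_closed)
  show ?thesis
  proof unfold_locales
    show "reflp_on (carrier (image_pomonoid h C L)) (leq (image_pomonoid h C L))"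
      using le_refl by (auto simp: image_pomonoid_def reflp_on_def)
    show "antisymp_on (carrier (image_pomonoid h C L)) (leq (image_pomonoid h C L))"
      unfolding antisymp_on_def image_pomonoid_def
      using antisymp_onD[OF le_antisym] by (auto intro!: arg_cong[of _ _ h])
    show "transp_on (carrier (image_pomonoid h C L)) (leq (image_pomonoid h C L))"
      unfolding transp_on_def image_pomonoid_def
      using transp_onD[OF le_trans] by (auto dest: C_carrier)
  qed (auto simp: image_pomonoid_def m_assoc m_comm m_lcomm intro!: mult_mono le_one)
qed

lemma eval_mset_image_pomonoid:
  assumes "inj_on h C" and C: "submonoid C L"
    and e: "evaluation L e" "range e \<subseteq> C"
  shows "eval_mset L e A \<in> C"
    and "eval_mset (image_pomonoid h C L) (h \<circ> e) A = h (eval_mset L e A)"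
proof -
  interpret I: integral_comm_pomonoid "image_pomonoid h C L"
    using assms by (intro image_pomonoid)
  have he: "evaluation (image_pomonoid h C L) (h \<circ> e)"
    using e(2) by (auto simp: evaluation_def image_pomonoid_def)
  \<comment> \<open>The claims are proved together: \<open>h\<close> is known to be multiplicative
    on \<open>C\<close> alone, so the step for the image needs the value of \<open>A\<close> to lie
    in \<open>C\<close>.\<close>
  have "eval_mset L e A \<in> C \<and>
      eval_mset (image_pomonoid h C L) (h \<circ> e) A = h (eval_mset L e A)"
  proof (induction A)
    case empty
    then show ?case
      unfolding I.eval_mset_empty eval_mset_empty
      using submonoid.one_closed[OF C] by (simp add: image_pomonoid_def)
  next
    case (add p A)
    have "e p \<in> C"
      using e by auto
    moreover have "h x \<otimes>\<^bsub>image_pomonoid h C L\<^esub> h y = h (x \<otimes> y)" if "x \<in> C" "y \<in> C" for x y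
      using that \<open>inj_on h C\<close> by (simp add: image_pomonoid_def)
    ultimately show ?case
      using add submonoid.m_closed[OF C]
        eval_mset_union[OF e(1), of "{#p#}" A] I.eval_mset_union[OF he, of "{#p#}" A]
        eval_mset_single[OF e(1)] I.eval_mset_single[OF he]
      by (simp add: comp_def)
  qed
  then show "eval_mset L e A \<in> C"
    and "eval_mset (image_pomonoid h C L) (h \<circ> e) A = h (eval_mset L e A)"
    by auto
qed

lemma eval_sat_image_pomonoid:
  assumes "inj_on h C" "submonoid C L" "evaluation L e" "range e \<subseteq> C"
  shows "eval_sat (image_pomonoid h C L) (h \<circ> e) \<phi> \<longleftrightarrow> eval_sat L e \<phi>"
  unfolding eval_sat_def eval_mset_image_pomonoid(2)[OF assms]
  using eval_mset_image_pomonoid(1)[OF assms] \<open>inj_on h C\<close>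
  by (simp add: image_pomonoid_def)

text \<open>This is the submonoid generated by the values of \<open>e\<close>. It is countable
  whenever there are only countably many multisets, however large \<open>L\<close> is.\<close>

lemma submonoid_range_eval_mset:
  assumes "evaluation L e"
  shows "submonoid (range (eval_mset L e)) L"
proof
  show "range (eval_mset L e) \<subseteq> carrier L"
    using assms by auto
  show "x \<otimes> y \<in> range (eval_mset L e)"
    if "x \<in> range (eval_mset L e)" "y \<in> range (eval_mset L e)" for x y
    using that by (auto simp: eval_mset_union[OF assms, symmetric])
  show "\<one> \<in> range (eval_mset L e)"
    by (rule range_eqI[of _ _ "{#}"]) simp
qed

end

lemma countable_UNIV_multiset: "countable (UNIV :: 'a :: countable multiset set)"
proof -
  have "countable (range (mset :: 'a list \<Rightarrow> 'a multiset))"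
    by simp
  then show ?thesis
    by (simp add: surj_mset)
qed

lemma countable_inj_on_infinite_type:
  assumes "countable C"
  obtains h :: "'a \<Rightarrow> 'b :: infinite" where "inj_on h C"
proof -
  obtain f :: "nat \<Rightarrow> 'b" where "inj f"
    using infinite_countable_subset[OF infinite_UNIV] by auto
  then show thesis
    using that[of "f \<circ> to_nat_on C"] inj_on_to_nat_on[OF assms]
    by (simp add: comp_inj_on inj_on_subset)
qed

text \<open>A model over \<open>'m\<close> is cut down to the countable submonoid of values of
  multisets and copied into \<open>'l\<close>. Satisfaction is equivalent on both sides, so \<Gamma>
  transfers to the copy and \<phi> transfers back.\<close>

lemma entails_change_type:
  fixes \<Gamma> :: "'v :: countable mfd set"
  assumes "entails TYPE('l :: infinite) \<Gamma> \<phi>"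
  shows "entails TYPE('m) \<Gamma> \<phi>"
  unfolding entails_def
proof (intro allI impI)
  fix L :: "'m pomonoid" and e
  assume L: "integral_comm_pomonoid L" and e: "eval_model L e \<Gamma>"
  interpret integral_comm_pomonoid L by fact
  let ?C = "range (eval_mset L e)"
  have ev: "evaluation L e"
    using e by (simp add: eval_model_def)
  obtain h :: "'m \<Rightarrow> 'l" where h: "inj_on h ?C"
    using countable_image[OF countable_UNIV_multiset]
    by (rule countable_inj_on_infinite_type)
  note C = submonoid_range_eval_mset[OF ev]
  have range_e: "range e \<subseteq> ?C"
    by (rule image_subsetI, rule range_eqI, rule eval_mset_single[OF ev, symmetric])
  have sat: "eval_sat (image_pomonoid h ?C L) (h \<circ> e) \<psi> \<longleftrightarrow> eval_sat L e \<psi>" for \<psi>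
    by (rule eval_sat_image_pomonoid[OF h C ev range_e])
  have "eval_model (image_pomonoid h ?C L) (h \<circ> e) \<Gamma>"
    using e range_e unfolding eval_model_def sat
    by (auto simp: evaluation_def image_pomonoid_def image_subset_iff)
  then show "eval_sat L e \<phi>"
    using assms image_pomonoid[OF h C] unfolding entails_def sat[symmetric] by blast
qed

text \<open>The bridge used in both directions: attributes of \<open>R\<close> outside
  \<open>E\<close> contribute zeroth powers, so the product over \<open>R\<close> reduces to the one
  over the support of \<open>E\<close>.\<close>

lemma tuple_similarity_eq_eval_mset:
  assumes "integral_comm_pomonoid (degrees r)" "evaluation (degrees r) e"
    and "finite R" "set_mset E \<subseteq> R"
    and "\<And>p. p \<in> R \<Longrightarrow> similarity r p (t1 p) (t2 p) = e p"
  shows "tuple_similarity R r E t1 t2 = eval_mset (degrees r) e E"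
proof -
  interpret integral_comm_pomonoid "degrees r" by fact
  have "tuple_similarity R r E t1 t2 =
      (\<Otimes>\<^bsub>degrees r\<^esub>p\<in>R. e p [^]\<^bsub>degrees r\<^esub> count E p)"
    unfolding tuple_similarity_def
    using assms by (intro finprod_cong') (auto simp: evaluation_def)
  then show ?thesis
    using assms eval_mset_superset by metis
qed

lemma entails_imp_rel_entails:
  assumes "entails TYPE('m) \<Gamma> \<phi>"
    and "mfd_vars \<phi> \<subseteq> R" and "\<And>\<psi>. \<psi> \<in> \<Gamma> \<Longrightarrow> mfd_vars \<psi> \<subseteq> R"
  shows "rel_entails TYPE('d) TYPE('m) R \<Gamma> \<phi>"
  unfolding rel_entails_def
proof (intro allI impI)
  fix r :: "('a, 'd, 'm) mrelation"
  assume r: "rel_model R r \<Gamma>"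
  then interpret relation_on R r
    by (simp add: rel_model_def)
  interpret integral_comm_pomonoid "degrees r"
    by (rule degrees_pomonoid)
  show "rel_sat R r \<phi>"
    unfolding rel_sat_def
  proof (intro ballI)
    fix t1 t2
    assume t: "t1 \<in> tuples r" "t2 \<in> tuples r"
    \<comment> \<open>\<open>evaluation\<close> constrains every variable, whereas similarities are
      controlled on \<open>R\<close> only. Outside \<open>R\<close> any element of the carrier would
      serve as default.\<close>
    define e where
      "e p = (if p \<in> R then similarity r p (t1 p) (t2 p) else \<one>\<^bsub>degrees r\<^esub>)" for p
    have "t1 p \<in> attr_domain r p" "t2 p \<in> attr_domain r p" if "p \<in> R" for p
      using t tuples_subset that by (auto simp: PiE_iff)
    then have ev: "evaluation (degrees r) e"
      by (auto simp: evaluation_def e_def similarity_closed)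
    have sim: "tuple_similarity R r E t1 t2 = eval_mset (degrees r) e E"
      if "set_mset E \<subseteq> R" for E
      using that degrees_pomonoid ev finite_scheme
      by (intro tuple_similarity_eq_eval_mset) (auto simp: e_def)
    have "eval_sat (degrees r) e \<psi>" if "\<psi> \<in> \<Gamma>" for \<psi>
      using r that assms(3)[OF that] t
      by (auto simp: rel_model_def rel_sat_def eval_sat_def mfd_vars_def simp flip: sim)
    then have "eval_sat (degrees r) e \<phi>"
      using assms(1) degrees_pomonoid ev unfolding entails_def eval_model_def by blast
    then show "tuple_similarity R r (lhs \<phi>) t1 t2 \<preceq>\<^bsub>degrees r\<^esub>
        tuple_similarity R r (rhs \<phi>) t1 t2"
      using assms(2) by (simp add: eval_sat_def mfd_vars_def sim)
  qed
qed

lemma rel_entails_imp_entails: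
  assumes "rel_entails TYPE('d :: infinite) TYPE('m) R \<Gamma> \<phi>" and "finite R"
    and "mfd_vars \<phi> \<subseteq> R" and "\<And>\<psi>. \<psi> \<in> \<Gamma> \<Longrightarrow> mfd_vars \<psi> \<subseteq> R"
  shows "entails TYPE('m) \<Gamma> \<phi>"
  unfolding entails_def
proof (intro allI impI)
  fix L :: "'m pomonoid" and e
  assume L: "integral_comm_pomonoid L" and e: "eval_model L e \<Gamma>"
  interpret integral_comm_pomonoid L by fact
  have ev: "evaluation L e"
    using e by (simp add: eval_model_def)
  obtain d0 d1 :: 'd where d: "d0 \<noteq> d1"
    by (metis (full_types) ex_new_if_finite finite.emptyI finite.insertI infinite_UNIV insertI1)
  \<comment> \<open>The tuples differ at every attribute of \<open>R\<close>. If \<open>R\<close> is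
    empty they coincide, and all degrees are the empty product.\<close>
  define t0 t1 where "t0 = (\<lambda>p\<in>R. d0)" and "t1 = (\<lambda>p\<in>R. d1)"
  define r where "r = \<lparr>tuples = {t0, t1}, attr_domain = \<lambda>_. UNIV, degrees = L,
    similarity = \<lambda>p x y. if x = y then \<one>\<^bsub>L\<^esub> else e p\<rparr>"
  have rel: "relation_on R r"
    using \<open>finite R\<close> L ev
    by (intro relation_on.intro)
      (auto simp: r_def t0_def t1_def evaluation_def)
  have off_diag: "tuple_similarity R r E t0 t1 = eval_mset L e E"
      "tuple_similarity R r E t1 t0 = eval_mset L e E" if "set_mset E \<subseteq> R" for E
    using tuple_similarity_eq_eval_mset[of r e R E t0 t1]
      tuple_similarity_eq_eval_mset[of r e R E t1 t0] \<open>finite R\<close> L ev d that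
    by (simp_all add: r_def t0_def t1_def)
  have diag: "tuple_similarity R r E t t = \<one>\<^bsub>L\<^esub>" for E t
    by (simp add: tuple_similarity_def r_def)
  \<comment> \<open>This settles the diagonal pairs for every dependency; the two mixed pairs both
    express satisfaction under \<open>e\<close>.\<close>
  have "\<one>\<^bsub>L\<^esub> \<preceq>\<^bsub>L\<^esub> \<one>\<^bsub>L\<^esub>"
    by (simp add: le_one)
  then have sat: "rel_sat R r \<psi> \<longleftrightarrow> eval_sat L e \<psi>" if "mfd_vars \<psi> \<subseteq> R" for \<psi>
    using that off_diag[of "lhs \<psi>"] off_diag[of "rhs \<psi>"] diag
    by (auto simp: rel_sat_def eval_sat_def mfd_vars_def r_def)
  have "rel_model R r \<Gamma>"
    using rel e sat assms(4) by (auto simp: rel_model_def eval_model_def)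
  then show "eval_sat L e \<phi>"
    using assms(1,3) sat unfolding rel_entails_def by blast
qed

theorem theorem10:
  fixes \<Gamma> :: "('v :: {countable, infinite}) mfd set"
    and A B :: "'v multiset"
    and R :: "'v set"
  assumes "finite \<Gamma>"
    and "finite R"
    and "mfd_vars (A \<leadsto> B) \<subseteq> R"
    and "\<And>\<phi>. \<phi> \<in> \<Gamma> \<Longrightarrow> mfd_vars \<phi> \<subseteq> R"
  shows "entails TYPE('l :: infinite) \<Gamma> (A \<leadsto> B) \<longleftrightarrow>
         rel_entails TYPE('d :: infinite) TYPE('m :: infinite) R \<Gamma> (A \<leadsto> B)"
proof
  assume "entails TYPE('l) \<Gamma> (A \<leadsto> B)"
  \<comment> \<open>Evaluations and relations are compared over one common type of degrees, so
    entailment first moves from \<open>'l\<close> to \<open>'m\<close>.\<close>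
  then have "entails TYPE('m) \<Gamma> (A \<leadsto> B)"
    by (rule entails_change_type)
  then show "rel_entails TYPE('d) TYPE('m) R \<Gamma> (A \<leadsto> B)"
    using assms by (intro entails_imp_rel_entails)
next
  assume "rel_entails TYPE('d) TYPE('m) R \<Gamma> (A \<leadsto> B)"
  then have "entails TYPE('m) \<Gamma> (A \<leadsto> B)"
    using assms by (intro rel_entails_imp_entails)
  then show "entails TYPE('l) \<Gamma> (A \<leadsto> B)"
    by (rule entails_change_type)
qed

end
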